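(* Let $\mathcal{T}$, $\mathcal{S}$ be triangulated categories and let $F:\mathcal{T}\to\mathcal{S}$ be a full triangulated functor with its natural isomorphism $\varphi:F\Sigma\Rightarrow\Sigma F$. If $\{B_n\}_{n\in\mathbb{N}}$ is a metric on $\mathcal{T}$, then $\{F(B_n)\}_{n\in\mathbb{N}}$ is a metric on $\mathcal{S}$. Furthermore, if $\{B_n\}_{n\in\mathbb{N}}$ is a good metric on $\mathcal{T}$, then $\{F(B_n)\}_{n\in\mathbb{N}}$ is a good metric on $\mathcal{S}$.
   Context: $\mathbb{N}=\{1,2,\dots\}$. All subcategories are full. Let $\mathcal{T}$ be a triangulated category with shift $\Sigma$. For subcategories $\mathcal{X},\mathcal{Z}\subseteq\mathcal{T}$, $\mathcal{X}*\mathcal{Z}$ is the subcategory of all objects $T$ admitting a distinguished triangle $X\to T\to Z\to\Sigma X$ with $X\in\mathcal{X}$, $Z\in\mathcal{Z}$. A metric on $\mathcal{T}$ is a non-increasing chain $B_1\supseteq B_2\supseteq\cdots$ of subcategories of $\mathcal{T}$ with $B_n*B_n=B_n$ and $0\in B_n$ for all $n$. It is good if $\Sigma^{-1}B_{n+1}\cup B_{n+1}\cup\Sigma B_{n+1}\subseteq B_n$ for all $n$. For a functor $F:\mathcal{T}\to\mathcal{S}$ and a metric $\{B_n\}$ on $\mathcal{T}$, $F(B_n)$ denotes the subcategory $\{Z\in\mathcal{S}: Z\simeq F(X)\text{ for some }X\in B_n\}$ of $\mathcal{S}$. *)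

theory Defs
  imports "HOL-Algebra.Group"
begin

record ('o, 'm) cat =
  Obj :: "'o set"
  Arr :: "'m set"
  Dom :: "'m \<Rightarrow> 'o"
  Cod :: "'m \<Rightarrow> 'o"
  Ident :: "'o \<Rightarrow> 'm"
  Comp :: "'m \<Rightarrow> 'm \<Rightarrow> 'm" (infixr "\<cdot>\<index>" 75)

definition Hom :: "('o, 'm, 'x) cat_scheme \<Rightarrow> 'o \<Rightarrow> 'o \<Rightarrow> 'm set" where
  "Hom C X Y = {f \<in> Arr C. Dom C f = X \<and> Cod C f = Y}"

locale category =
  fixes C :: "('o, 'm, 'x) cat_scheme" (structure)
  assumes Dom_closed: "f \<in> Arr C \<Longrightarrow> Dom C f \<in> Obj C"
    and Cod_closed: "f \<in> Arr C \<Longrightarrow> Cod C f \<in> Obj C"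
    and Ident_closed: "X \<in> Obj C \<Longrightarrow> Ident C X \<in> Hom C X X"
    and Comp_closed: "\<lbrakk>f \<in> Hom C X Y; g \<in> Hom C Y Z\<rbrakk> \<Longrightarrow> g \<cdot> f \<in> Hom C X Z"
    and Ident_left: "f \<in> Hom C X Y \<Longrightarrow> Ident C Y \<cdot> f = f"
    and Ident_right: "f \<in> Hom C X Y \<Longrightarrow> f \<cdot> Ident C X = f"
    and Comp_assoc: "\<lbrakk>f \<in> Hom C W X; g \<in> Hom C X Y; h \<in> Hom C Y Z\<rbrakk>
      \<Longrightarrow> (h \<cdot> g) \<cdot> f = h \<cdot> (g \<cdot> f)"

definition iso_arr :: "('o, 'm, 'x) cat_scheme \<Rightarrow> 'o \<Rightarrow> 'o \<Rightarrow> 'm \<Rightarrow> bool" where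
  "iso_arr C X Y f \<longleftrightarrow> f \<in> Hom C X Y \<and>
     (\<exists>g \<in> Hom C Y X. g \<cdot>\<^bsub>C\<^esub> f = Ident C X \<and> f \<cdot>\<^bsub>C\<^esub> g = Ident C Y)"

definition isomorphic :: "('o, 'm, 'x) cat_scheme \<Rightarrow> 'o \<Rightarrow> 'o \<Rightarrow> bool" where
  "isomorphic C X Y \<longleftrightarrow> (\<exists>f. iso_arr C X Y f)"

definition zero_obj :: "('o, 'm, 'x) cat_scheme \<Rightarrow> 'o \<Rightarrow> bool" where
  "zero_obj C Z \<longleftrightarrow> Z \<in> Obj C \<and>
     (\<forall>X \<in> Obj C. (\<exists>!f. f \<in> Hom C X Z) \<and> (\<exists>!f. f \<in> Hom C Z X))"

record ('o, 'm, 'p, 'q) fun_data =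
  fobj :: "'o \<Rightarrow> 'p"
  farr :: "'m \<Rightarrow> 'q"

definition is_functor ::
  "('o, 'm, 'x) cat_scheme \<Rightarrow> ('p, 'q, 'y) cat_scheme \<Rightarrow> ('o, 'm, 'p, 'q) fun_data \<Rightarrow> bool" where
  "is_functor C D F \<longleftrightarrow>
     (\<forall>X \<in> Obj C. fobj F X \<in> Obj D) \<and>
     (\<forall>X Y f. f \<in> Hom C X Y \<longrightarrow> farr F f \<in> Hom D (fobj F X) (fobj F Y)) \<and>
     (\<forall>X \<in> Obj C. farr F (Ident C X) = Ident D (fobj F X)) \<and>
     (\<forall>X Y Z f g. f \<in> Hom C X Y \<longrightarrow> g \<in> Hom C Y Z \<longrightarrow>
        farr F (g \<cdot>\<^bsub>C\<^esub> f) = farr F g \<cdot>\<^bsub>D\<^esub> farr F f)"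

definition full_functor ::
  "('o, 'm, 'x) cat_scheme \<Rightarrow> ('p, 'q, 'y) cat_scheme \<Rightarrow> ('o, 'm, 'p, 'q) fun_data \<Rightarrow> bool" where
  "full_functor C D F \<longleftrightarrow> is_functor C D F \<and>
     (\<forall>X \<in> Obj C. \<forall>Y \<in> Obj C. \<forall>g \<in> Hom D (fobj F X) (fobj F Y). \<exists>f \<in> Hom C X Y. farr F f = g)"

definition id_fun :: "('o, 'm, 'o, 'm) fun_data" where
  "id_fun = \<lparr>fobj = (\<lambda>X. X), farr = (\<lambda>f. f)\<rparr>"

definition comp_fun ::
  "('p, 'q, 'r, 's) fun_data \<Rightarrow> ('o, 'm, 'p, 'q) fun_data \<Rightarrow> ('o, 'm, 'r, 's) fun_data"
  (infixr "\<circ>\<circ>" 75) where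
  "G \<circ>\<circ> F = \<lparr>fobj = (\<lambda>X. fobj G (fobj F X)), farr = (\<lambda>f. farr G (farr F f))\<rparr>"

definition nat_iso ::
  "('o, 'm, 'x) cat_scheme \<Rightarrow> ('p, 'q, 'y) cat_scheme \<Rightarrow>
   ('o, 'm, 'p, 'q) fun_data \<Rightarrow> ('o, 'm, 'p, 'q) fun_data \<Rightarrow> ('o \<Rightarrow> 'q) \<Rightarrow> bool" where
  "nat_iso C D F G \<eta> \<longleftrightarrow>
     (\<forall>X \<in> Obj C. iso_arr D (fobj F X) (fobj G X) (\<eta> X)) \<and>
     (\<forall>X Y f. f \<in> Hom C X Y \<longrightarrow> \<eta> Y \<cdot>\<^bsub>D\<^esub> farr F f = farr G f \<cdot>\<^bsub>D\<^esub> \<eta> X)"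

definition ess_image ::
  "('p, 'q, 'y) cat_scheme \<Rightarrow> ('o, 'm, 'p, 'q) fun_data \<Rightarrow> 'o set \<Rightarrow> 'p set" where
  "ess_image D F A = {Z \<in> Obj D. \<exists>X \<in> A. isomorphic D Z (fobj F X)}"

record ('o, 'm) add_cat = "('o, 'm) cat" +
  Plus :: "'m \<Rightarrow> 'm \<Rightarrow> 'm" (infixl "\<oplus>\<index>" 65)
  Zero :: "'o \<Rightarrow> 'o \<Rightarrow> 'm"

definition Hom_group :: "('o, 'm, 'x) add_cat_scheme \<Rightarrow> 'o \<Rightarrow> 'o \<Rightarrow> 'm monoid" where
  "Hom_group C X Y = \<lparr>carrier = Hom C X Y, mult = Plus C, one = Zero C X Y\<rparr>"

definition Neg :: "('o, 'm, 'x) add_cat_scheme \<Rightarrow> 'm \<Rightarrow> 'm" where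
  "Neg C f = inv\<^bsub>Hom_group C (Dom C f) (Cod C f)\<^esub> f"

locale additive_category = category C for C :: "('o, 'm, 'x) add_cat_scheme" (structure) +
  assumes Hom_comm_group: "\<lbrakk>X \<in> Obj C; Y \<in> Obj C\<rbrakk> \<Longrightarrow> comm_group (Hom_group C X Y)"
    and Comp_Plus_right: "\<lbrakk>f \<in> Hom C X Y; f' \<in> Hom C X Y; g \<in> Hom C Y Z\<rbrakk>
      \<Longrightarrow> g \<cdot> (f \<oplus> f') = g \<cdot> f \<oplus> g \<cdot> f'"
    and Comp_Plus_left: "\<lbrakk>f \<in> Hom C X Y; g \<in> Hom C Y Z; g' \<in> Hom C Y Z\<rbrakk>
      \<Longrightarrow> (g \<oplus> g') \<cdot> f = g \<cdot> f \<oplus> g' \<cdot> f"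
    and zero_obj_exists: "\<exists>Z. zero_obj C Z"
    and biproduct_exists: "\<lbrakk>X \<in> Obj C; Y \<in> Obj C\<rbrakk> \<Longrightarrow>
      \<exists>P \<in> Obj C. \<exists>i \<in> Hom C X P. \<exists>j \<in> Hom C Y P. \<exists>p \<in> Hom C P X. \<exists>q \<in> Hom C P Y.
        p \<cdot> i = Ident C X \<and> q \<cdot> j = Ident C Y \<and> q \<cdot> i = Zero C X Y \<and> p \<cdot> j = Zero C Y X \<and>
        i \<cdot> p \<oplus> j \<cdot> q = Ident C P"

definition additive_functor ::
  "('o, 'm, 'x) add_cat_scheme \<Rightarrow> ('p, 'q, 'y) add_cat_scheme \<Rightarrow> ('o, 'm, 'p, 'q) fun_data \<Rightarrow> bool"
  where
  "additive_functor C D F \<longleftrightarrow> is_functor C D F \<and>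
     (\<forall>X Y f g. f \<in> Hom C X Y \<longrightarrow> g \<in> Hom C X Y \<longrightarrow>
        farr F (f \<oplus>\<^bsub>C\<^esub> g) = farr F f \<oplus>\<^bsub>D\<^esub> farr F g)"

text \<open>
  The shift is only required to be an autoequivalence, and \<open>Unshift\<close> is a chosen quasi-inverse
  of it, written $\Sigma^{-1}$; if the shift is an automorphism of the category, \<open>Unshift\<close> can be
  taken to be its strict inverse.  A triple \<open>(f, g, h)\<close> in \<open>Tri\<close> stands for the distinguished
  triangle $X \to Y \to Z \to \Sigma X$ whose vertices are read off from the arrows.
\<close>

record ('o, 'm) tri_cat = "('o, 'm) add_cat" +
  Shift :: "('o, 'm, 'o, 'm) fun_data"
  Unshift :: "('o, 'm, 'o, 'm) fun_data"
  Tri :: "('m \<times> 'm \<times> 'm) set"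

definition candidate ::
  "('o, 'm, 'x) tri_cat_scheme \<Rightarrow> 'o \<Rightarrow> 'o \<Rightarrow> 'o \<Rightarrow> 'm \<Rightarrow> 'm \<Rightarrow> 'm \<Rightarrow> bool" where
  "candidate C X Y Z f g h \<longleftrightarrow> X \<in> Obj C \<and> Y \<in> Obj C \<and> Z \<in> Obj C \<and>
     f \<in> Hom C X Y \<and> g \<in> Hom C Y Z \<and> h \<in> Hom C Z (fobj (Shift C) X)"

definition dist_triangle ::
  "('o, 'm, 'x) tri_cat_scheme \<Rightarrow> 'o \<Rightarrow> 'o \<Rightarrow> 'o \<Rightarrow> 'm \<Rightarrow> 'm \<Rightarrow> 'm \<Rightarrow> bool" where
  "dist_triangle C X Y Z f g h \<longleftrightarrow> candidate C X Y Z f g h \<and> (f, g, h) \<in> Tri C"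

locale triangulated_category = additive_category C
  for C :: "('o, 'm, 'x) tri_cat_scheme" (structure) +
  assumes Shift_additive: "additive_functor C C (Shift C)"
    and Unshift_functor: "is_functor C C (Unshift C)"
    and Unshift_Shift: "\<exists>\<eta>. nat_iso C C id_fun (Unshift C \<circ>\<circ> Shift C) \<eta>"
    and Shift_Unshift: "\<exists>\<epsilon>. nat_iso C C (Shift C \<circ>\<circ> Unshift C) id_fun \<epsilon>"
    and Tri_candidate: "(f, g, h) \<in> Tri C \<Longrightarrow> \<exists>X Y Z. candidate C X Y Z f g h"
    and TR1_iso: "\<lbrakk>dist_triangle C X Y Z f g h; candidate C X' Y' Z' f' g' h';
        iso_arr C X X' a; iso_arr C Y Y' b; iso_arr C Z Z' c;
        b \<cdot> f = f' \<cdot> a; c \<cdot> g = g' \<cdot> b; farr (Shift C) a \<cdot> h = h' \<cdot> c\<rbrakk>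
      \<Longrightarrow> dist_triangle C X' Y' Z' f' g' h'"
    and TR1_ident: "\<lbrakk>X \<in> Obj C; zero_obj C Z\<rbrakk>
      \<Longrightarrow> dist_triangle C X X Z (Ident C X) (Zero C X Z) (Zero C Z (fobj (Shift C) X))"
    and TR1_cone: "f \<in> Hom C X Y \<Longrightarrow> \<exists>Z g h. dist_triangle C X Y Z f g h"
    and TR2: "candidate C X Y Z f g h \<Longrightarrow>
      dist_triangle C X Y Z f g h \<longleftrightarrow> dist_triangle C Y Z (fobj (Shift C) X) g h (Neg C (farr (Shift C) f))"
    and TR3: "\<lbrakk>dist_triangle C X Y Z f g h; dist_triangle C X' Y' Z' f' g' h';
        a \<in> Hom C X X'; b \<in> Hom C Y Y'; b \<cdot> f = f' \<cdot> a\<rbrakk>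
      \<Longrightarrow> \<exists>c \<in> Hom C Z Z'. c \<cdot> g = g' \<cdot> b \<and> farr (Shift C) a \<cdot> h = h' \<cdot> c"
    and TR4: "\<lbrakk>dist_triangle C X Y Z' u j k; dist_triangle C Y Z X' v l i; dist_triangle C X Z Y' (v \<cdot> u) m n\<rbrakk>
      \<Longrightarrow> \<exists>f \<in> Hom C Z' Y'. \<exists>g \<in> Hom C Y' X'.
            dist_triangle C Z' Y' X' f g (farr (Shift C) j \<cdot> i) \<and>
            f \<cdot> j = m \<cdot> v \<and> n \<cdot> f = k \<and> g \<cdot> m = l \<and> i \<cdot> g = farr (Shift C) u \<cdot> n"

definition triangulated_functor ::
  "('o, 'm, 'x) tri_cat_scheme \<Rightarrow> ('p, 'q, 'y) tri_cat_scheme \<Rightarrow>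
   ('o, 'm, 'p, 'q) fun_data \<Rightarrow> ('o \<Rightarrow> 'q) \<Rightarrow> bool" where
  "triangulated_functor C D F \<phi> \<longleftrightarrow>
     additive_functor C D F \<and>
     nat_iso C D (F \<circ>\<circ> Shift C) (Shift D \<circ>\<circ> F) \<phi> \<and>
     (\<forall>X Y Z f g h. dist_triangle C X Y Z f g h \<longrightarrow>
        dist_triangle D (fobj F X) (fobj F Y) (fobj F Z) (farr F f) (farr F g) (\<phi> X \<cdot>\<^bsub>D\<^esub> farr F h))"

text \<open>A full subcategory is represented by its set of objects.\<close>

definition ext_prod :: "('o, 'm, 'x) tri_cat_scheme \<Rightarrow> 'o set \<Rightarrow> 'o set \<Rightarrow> 'o set" where
  "ext_prod C A B = {Y \<in> Obj C. \<exists>X \<in> A. \<exists>Z \<in> B. \<exists>f g h. dist_triangle C X Y Z f g h}"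

text \<open>
  Metrics are indexed by the positive integers, so the value \<open>B 0\<close> is irrelevant.  Since
  \<open>B n * B n = B n\<close> and \<open>B n\<close> contains a zero object, \<open>B n\<close> is closed under isomorphism and hence
  contains all zero objects.
\<close>

definition metric :: "('o, 'm, 'x) tri_cat_scheme \<Rightarrow> (nat \<Rightarrow> 'o set) \<Rightarrow> bool" where
  "metric C B \<longleftrightarrow> (\<forall>n \<ge> 1.
     B n \<subseteq> Obj C \<and>
     B (Suc n) \<subseteq> B n \<and>
     ext_prod C (B n) (B n) = B n \<and>
     (\<exists>Z \<in> B n. zero_obj C Z))"

definition good_metric :: "('o, 'm, 'x) tri_cat_scheme \<Rightarrow> (nat \<Rightarrow> 'o set) \<Rightarrow> bool" where
  "good_metric C B \<longleftrightarrow> metric C B \<and> (\<forall>n \<ge> 1.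
     ess_image C (Unshift C) (B (Suc n)) \<union> B (Suc n) \<union> ess_image C (Shift C) (B (Suc n)) \<subseteq> B n)"

end

theory Submission
  imports Defs
begin

text \<open>
  Only one inclusion is more than bookkeeping: that the essential image \<open>F(B)\<close> of an
  extension-closed \<open>B\<close> is again extension-closed.  A triangle whose outer vertices lie in \<open>F(B)\<close>
  is determined, up to isomorphism of its middle vertex, by its connecting morphism
  (\<open>middle_unique\<close>).  After transport along isomorphisms and along \<open>\<phi>\<close>, that morphism becomes an
  arrow $F Z' \to F \Sigma X'$ with \<open>X'\<close>, \<open>Z'\<close> in \<open>B\<close>.  Fullness writes it as \<open>F\<close> of an arrow
  $Z' \to \Sigma X'$, which is the connecting morphism of some triangle of the source category
  (\<open>cocone_exists\<close>).  The middle vertex of that triangle lies in \<open>B\<close>, and \<open>F\<close> sends the triangle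
  to one with the same connecting morphism as the given triangle, so the given middle vertex lies
  in \<open>F(B)\<close>.

  The goodness condition carries over because \<open>F\<close> commutes up to isomorphism with the shift, hence
  also with its quasi-inverse, since the shift reflects isomorphism of objects.

  The uniqueness of cones is the usual consequence of the five lemma.  Here it is derived without
  long exact sequences: an endomorphism of a triangle that is the identity on the first two
  vertices differs from the identity on the third by an endomorphism of square zero.
\<close>

section \<open>Isomorphisms\<close>

lemma HomD:
  "f \<in> Hom C X Y \<Longrightarrow> f \<in> Arr C" "f \<in> Hom C X Y \<Longrightarrow> Dom C f = X" "f \<in> Hom C X Y \<Longrightarrow> Cod C f = Y"
  by (auto simp: Hom_def)

lemma iso_arr_Hom: "iso_arr C X Y f \<Longrightarrow> f \<in> Hom C X Y"
  by (simp add: iso_arr_def)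

lemma iso_arrE:
  assumes "iso_arr C X Y f"
  obtains g where "f \<in> Hom C X Y" "g \<in> Hom C Y X"
    "g \<cdot>\<^bsub>C\<^esub> f = Ident C X" "f \<cdot>\<^bsub>C\<^esub> g = Ident C Y" "iso_arr C Y X g"
  using assms unfolding iso_arr_def by blast

context category
begin

lemma Hom_Obj: "f \<in> Hom C X Y \<Longrightarrow> X \<in> Obj C" "f \<in> Hom C X Y \<Longrightarrow> Y \<in> Obj C"
  using Dom_closed Cod_closed by (auto simp: Hom_def)

lemma iso_arr_Ident: "X \<in> Obj C \<Longrightarrow> iso_arr C X X (Ident C X)"
  unfolding iso_arr_def using Ident_closed Ident_left by blast

lemma isomorphic_refl: "X \<in> Obj C \<Longrightarrow> isomorphic C X X"
  unfolding isomorphic_def using iso_arr_Ident by blast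

lemma isomorphic_sym: "isomorphic C X Y \<Longrightarrow> isomorphic C Y X"
  unfolding isomorphic_def by (meson iso_arrE)

lemma isomorphic_Obj:
  "isomorphic C X Y \<Longrightarrow> X \<in> Obj C" "isomorphic C X Y \<Longrightarrow> Y \<in> Obj C"
  unfolding isomorphic_def by (auto dest: iso_arr_Hom Hom_Obj)

lemma Comp_cancel_inner:
  assumes "f \<in> Hom C W X" "g \<in> Hom C X Y" "h \<in> Hom C Y X" "k \<in> Hom C X Z" "h \<cdot> g = Ident C X"
  shows "(k \<cdot> h) \<cdot> (g \<cdot> f) = k \<cdot> f"
  using Comp_assoc[OF Comp_closed[OF assms(1,2)] assms(3,4)] Comp_assoc[OF assms(1-3)]
    assms(5) Ident_left[OF assms(1)] by simp

lemma iso_arr_Comp: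
  assumes "iso_arr C X Y f" "iso_arr C Y Z g"
  shows "iso_arr C X Z (g \<cdot> f)"
proof -
  obtain f' where f: "f \<in> Hom C X Y" "f' \<in> Hom C Y X" "f' \<cdot> f = Ident C X" "f \<cdot> f' = Ident C Y"
    using assms(1) by (rule iso_arrE)
  obtain g' where g: "g \<in> Hom C Y Z" "g' \<in> Hom C Z Y" "g' \<cdot> g = Ident C Y" "g \<cdot> g' = Ident C Z"
    using assms(2) by (rule iso_arrE)
  have "(f' \<cdot> g') \<cdot> (g \<cdot> f) = Ident C X" "(g \<cdot> f) \<cdot> (f' \<cdot> g') = Ident C Z"
    using Comp_cancel_inner[OF f(1) g(1,2) f(2) g(3)] Comp_cancel_inner[OF g(2) f(2,1) g(1) f(4)]
      f(3) g(4) by simp_all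
  then show ?thesis
    unfolding iso_arr_def using Comp_closed[OF f(1) g(1)] Comp_closed[OF g(2) f(2)] by blast
qed

lemma isomorphic_trans:
  "isomorphic C X Y \<Longrightarrow> isomorphic C Y Z \<Longrightarrow> isomorphic C X Z"
  unfolding isomorphic_def using iso_arr_Comp by blast

lemma iso_arr_if_two_sided:
  assumes f: "f \<in> Hom C X Y" and g: "g \<in> Hom C Y X"
    and gf: "iso_arr C X X (g \<cdot> f)" and fg: "iso_arr C Y Y (f \<cdot> g)"
  shows "iso_arr C X Y f"
proof -
  obtain m where m: "m \<in> Hom C X X" "m \<cdot> (g \<cdot> f) = Ident C X"
    using gf by (rule iso_arrE)
  obtain k where k: "k \<in> Hom C Y Y" "(f \<cdot> g) \<cdot> k = Ident C Y"
    using fg by (rule iso_arrE)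
  let ?l = "m \<cdot> g" and ?r = "g \<cdot> k"
  have H: "?l \<in> Hom C Y X" "?r \<in> Hom C Y X"
    using Comp_closed[OF g m(1)] Comp_closed[OF k(1) g] by simp_all
  have l: "?l \<cdot> f = Ident C X" using Comp_assoc[OF f g m(1)] m by simp
  have r: "f \<cdot> ?r = Ident C Y" using Comp_assoc[OF k(1) g f] k by simp
  \<comment> \<open>A left inverse and a right inverse of the same arrow agree.\<close>
  have "?l = ?r"
    using Comp_assoc[OF H(2) f H(1)] l r Ident_left[OF H(2)] Ident_right[OF H(1)] by simp
  then show ?thesis using f H l r unfolding iso_arr_def by metis
qed

end

lemma is_functor_Hom:
  "is_functor C D F \<Longrightarrow> f \<in> Hom C X Y \<Longrightarrow> farr F f \<in> Hom D (fobj F X) (fobj F Y)"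
  by (simp add: is_functor_def)

lemma is_functor_Obj: "is_functor C D F \<Longrightarrow> X \<in> Obj C \<Longrightarrow> fobj F X \<in> Obj D"
  by (simp add: is_functor_def)

lemma is_functor_Ident:
  "is_functor C D F \<Longrightarrow> X \<in> Obj C \<Longrightarrow> farr F (Ident C X) = Ident D (fobj F X)"
  by (simp add: is_functor_def)

lemma is_functor_Comp:
  "is_functor C D F \<Longrightarrow> f \<in> Hom C X Y \<Longrightarrow> g \<in> Hom C Y Z \<Longrightarrow>
    farr F (g \<cdot>\<^bsub>C\<^esub> f) = farr F g \<cdot>\<^bsub>D\<^esub> farr F f"
  unfolding is_functor_def by blast

lemma functor_iso_arr:
  assumes "category C" "is_functor C D F" "iso_arr C X Y f"
  shows "iso_arr D (fobj F X) (fobj F Y) (farr F f)"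
proof -
  obtain g where g: "f \<in> Hom C X Y" "g \<in> Hom C Y X"
    "g \<cdot>\<^bsub>C\<^esub> f = Ident C X" "f \<cdot>\<^bsub>C\<^esub> g = Ident C Y"
    using assms(3) by (rule iso_arrE)
  have O: "X \<in> Obj C" "Y \<in> Obj C"
    using category.Hom_Obj[OF assms(1) g(1)] by auto
  have "farr F g \<cdot>\<^bsub>D\<^esub> farr F f = Ident D (fobj F X)" "farr F f \<cdot>\<^bsub>D\<^esub> farr F g = Ident D (fobj F Y)"
    using is_functor_Comp[OF assms(2) g(1,2)] is_functor_Comp[OF assms(2) g(2,1)] g(3,4)
      is_functor_Ident[OF assms(2) O(1)] is_functor_Ident[OF assms(2) O(2)] by simp_all
  then show ?thesis
    using is_functor_Hom[OF assms(2) g(1)] is_functor_Hom[OF assms(2) g(2)]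
    unfolding iso_arr_def by blast
qed

lemma functor_isomorphic:
  "category C \<Longrightarrow> is_functor C D F \<Longrightarrow> isomorphic C X Y \<Longrightarrow> isomorphic D (fobj F X) (fobj F Y)"
  unfolding isomorphic_def by (metis functor_iso_arr)

lemma nat_iso_isomorphic:
  "nat_iso C D F G \<eta> \<Longrightarrow> X \<in> Obj C \<Longrightarrow> isomorphic D (fobj F X) (fobj G X)"
  unfolding nat_iso_def isomorphic_def by blast

lemma ess_imageI:
  "category D \<Longrightarrow> isomorphic D Z (fobj F X) \<Longrightarrow> X \<in> A \<Longrightarrow> Z \<in> ess_image D F A"
  unfolding ess_image_def using category.isomorphic_Obj by fastforce

lemma ess_imageE:
  assumes "Z \<in> ess_image D F A"
  obtains X where "X \<in> A" "isomorphic D Z (fobj F X)"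
  using assms unfolding ess_image_def by blast

lemma ess_image_mono: "A \<subseteq> A' \<Longrightarrow> ess_image D F A \<subseteq> ess_image D F A'"
  unfolding ess_image_def by blast


section \<open>Zero morphisms and zero objects\<close>

context additive_category
begin

lemma Zero_closed: "X \<in> Obj C \<Longrightarrow> Y \<in> Obj C \<Longrightarrow> Zero C X Y \<in> Hom C X Y"
  using group.is_monoid[OF comm_group.axioms(2)[OF Hom_comm_group]] monoid.one_closed
  unfolding Hom_group_def by fastforce

lemma Plus_closed: "f \<in> Hom C X Y \<Longrightarrow> g \<in> Hom C X Y \<Longrightarrow> f \<oplus> g \<in> Hom C X Y"
  using monoid.m_closed[OF group.is_monoid[OF comm_group.axioms(2)[OF Hom_comm_group]], of X Y f g]
    Hom_Obj unfolding Hom_group_def by simp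

lemma Plus_comm: "f \<in> Hom C X Y \<Longrightarrow> g \<in> Hom C X Y \<Longrightarrow> f \<oplus> g = g \<oplus> f"
  using comm_monoid.m_comm[OF comm_group.axioms(1)[OF Hom_comm_group], of X Y f g]
    Hom_Obj unfolding Hom_group_def by simp

lemma Plus_Zero:
  assumes "f \<in> Hom C X Y"
  shows "Zero C X Y \<oplus> f = f" "f \<oplus> Zero C X Y = f"
  using monoid.l_one[OF group.is_monoid[OF comm_group.axioms(2)[OF Hom_comm_group]], of X Y f]
    monoid.r_one[OF group.is_monoid[OF comm_group.axioms(2)[OF Hom_comm_group]], of X Y f]
    Hom_Obj assms unfolding Hom_group_def by simp_all

lemma Plus_cancel:
  assumes "f \<in> Hom C X Y" "g \<in> Hom C X Y" "k \<in> Hom C X Y"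
  shows "f \<oplus> k = g \<oplus> k \<longleftrightarrow> f = g"
  using group.right_cancel[OF comm_group.axioms(2)[OF Hom_comm_group], of X Y k f g]
    Hom_Obj assms unfolding Hom_group_def by auto

lemma Neg_closed: "f \<in> Hom C X Y \<Longrightarrow> Neg C f \<in> Hom C X Y"
  using group.inv_closed[OF comm_group.axioms(2)[OF Hom_comm_group], of X Y f]
    Hom_Obj unfolding Neg_def by (simp add: HomD) (simp add: Hom_group_def)

lemma Neg_Neg: "f \<in> Hom C X Y \<Longrightarrow> Neg C (Neg C f) = f"
  using group.inv_inv[OF comm_group.axioms(2)[OF Hom_comm_group], of X Y f]
    Hom_Obj Neg_closed[of f X Y] HomD[of "Neg C f" C X Y] HomD[of f C X Y]
  unfolding Neg_def by (simp add: Hom_group_def)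

lemma Neg_Zero: "X \<in> Obj C \<Longrightarrow> Y \<in> Obj C \<Longrightarrow> Neg C (Zero C X Y) = Zero C X Y"
  using monoid.inv_one[OF group.is_monoid[OF comm_group.axioms(2)[OF Hom_comm_group]], of X Y]
    HomD[OF Zero_closed[of X Y]] unfolding Neg_def by (simp add: Hom_group_def)

lemma Neg_Plus: "f \<in> Hom C X Y \<Longrightarrow> Neg C f \<oplus> f = Zero C X Y"
  using group.l_inv[OF comm_group.axioms(2)[OF Hom_comm_group], of X Y f]
    Hom_Obj HomD[of f C X Y] unfolding Neg_def by (simp add: Hom_group_def)

lemma Plus_assoc:
  "f \<in> Hom C X Y \<Longrightarrow> g \<in> Hom C X Y \<Longrightarrow> k \<in> Hom C X Y \<Longrightarrow> (f \<oplus> g) \<oplus> k = f \<oplus> (g \<oplus> k)"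
  using monoid.m_assoc[OF group.is_monoid[OF comm_group.axioms(2)[OF Hom_comm_group]], of X Y f g k]
    Hom_Obj unfolding Hom_group_def by simp

lemma difference_exists:
  assumes "f \<in> Hom C X Y" "g \<in> Hom C X Y"
  obtains d where "d \<in> Hom C X Y" "d \<oplus> f = g"
proof
  show "g \<oplus> Neg C f \<in> Hom C X Y" using Plus_closed Neg_closed assms by blast
  show "g \<oplus> Neg C f \<oplus> f = g"
    using Plus_assoc[OF assms(2) Neg_closed[OF assms(1)] assms(1)] Neg_Plus[OF assms(1)]
      Plus_Zero[OF assms(2)] by simp
qed

text \<open>
  Zero morphisms are recognised as the additive idempotents, a property that every
  additive operation preserves at once.
\<close>

lemma Zero_eq_if_idem: "f \<in> Hom C X Y \<Longrightarrow> f \<oplus> f = f \<Longrightarrow> f = Zero C X Y"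
  using Plus_cancel[of f X Y "Zero C X Y" f] Plus_Zero(1)[of f X Y] Zero_closed[OF Hom_Obj]
  by simp

lemma Comp_Zero:
  assumes "g \<in> Hom C Y Z" "X \<in> Obj C"
  shows "g \<cdot> Zero C X Y = Zero C X Z"
proof -
  note z = Zero_closed[OF assms(2) Hom_Obj(1)[OF assms(1)]]
  show ?thesis
    using Zero_eq_if_idem[OF Comp_closed[OF z assms(1)]] Comp_Plus_right[OF z z assms(1)]
      Plus_Zero[OF z] by simp
qed

lemma Zero_Comp:
  assumes "f \<in> Hom C X Y" "Z \<in> Obj C"
  shows "Zero C Y Z \<cdot> f = Zero C X Z"
proof -
  note z = Zero_closed[OF Hom_Obj(2)[OF assms(1)] assms(2)]
  show ?thesis
    using Zero_eq_if_idem[OF Comp_closed[OF assms(1) z]] Comp_Plus_left[OF assms(1) z z]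
      Plus_Zero[OF z] by simp
qed

text \<open>
  In this equational form, being a zero object is visibly preserved by additive functors.
\<close>

lemma zero_obj_iff: "zero_obj C X \<longleftrightarrow> X \<in> Obj C \<and> Ident C X = Zero C X X"
proof
  assume "zero_obj C X"
  then show "X \<in> Obj C \<and> Ident C X = Zero C X X"
    unfolding zero_obj_def using Ident_closed Zero_closed by blast
next
  assume X: "X \<in> Obj C \<and> Ident C X = Zero C X X"
  have "f = Zero C Y X" if "f \<in> Hom C Y X" for f Y
    using Ident_left[OF that] Zero_Comp[OF that] X by simp
  moreover have "f = Zero C X Y" if "f \<in> Hom C X Y" for f Y
    using Ident_right[OF that] Comp_Zero[OF that] X by simp
  ultimately show "zero_obj C X"
    unfolding zero_obj_def using X Zero_closed by metis
qed

end

lemma additive_functor_Zero: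
  assumes "additive_category C" "additive_category D" "additive_functor C D F"
    and "X \<in> Obj C" "Y \<in> Obj C"
  shows "farr F (Zero C X Y) = Zero D (fobj F X) (fobj F Y)"
proof -
  interpret C: additive_category C by fact
  interpret D: additive_category D by fact
  have F: "is_functor C D F" using assms(3) by (simp add: additive_functor_def)
  note Z = C.Zero_closed[OF assms(4,5)]
  have "farr F (Zero C X Y) \<oplus>\<^bsub>D\<^esub> farr F (Zero C X Y) = farr F (Zero C X Y)"
    using assms(3) Z C.Plus_Zero[OF Z] unfolding additive_functor_def by metis
  then show ?thesis
    using D.Zero_eq_if_idem is_functor_Hom[OF F Z] by blast
qed

lemma additive_functor_zero_obj:
  assumes "additive_category C" "additive_category D" "additive_functor C D F" "zero_obj C Z"
  shows "zero_obj D (fobj F Z)"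
proof -
  have F: "is_functor C D F" using assms(3) by (simp add: additive_functor_def)
  have Z: "Z \<in> Obj C" "Ident C Z = Zero C Z Z"
    using assms(4) additive_category.zero_obj_iff[OF assms(1)] by auto
  have "Ident D (fobj F Z) = Zero D (fobj F Z) (fobj F Z)"
    using is_functor_Ident[OF F Z(1)] additive_functor_Zero[OF assms(1-3) Z(1) Z(1)] Z(2) by simp
  then show ?thesis
    using additive_category.zero_obj_iff[OF assms(2)] is_functor_Obj[OF F Z(1)] by simp
qed


section \<open>The shift as an equivalence\<close>

lemma dist_triangleD:
  assumes "dist_triangle C X Y Z f g h"
  shows "X \<in> Obj C" "Y \<in> Obj C" "Z \<in> Obj C" "f \<in> Hom C X Y" "g \<in> Hom C Y Z"
    "h \<in> Hom C Z (fobj (Shift C) X)" "candidate C X Y Z f g h"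
  using assms by (auto simp: dist_triangle_def candidate_def)

context triangulated_category
begin

abbreviation \<Sigma> :: "'o \<Rightarrow> 'o" where "\<Sigma> \<equiv> fobj (Shift C)"
abbreviation \<Sigma>\<^sub>a :: "'m \<Rightarrow> 'm" where "\<Sigma>\<^sub>a \<equiv> farr (Shift C)"
abbreviation \<Omega> :: "'o \<Rightarrow> 'o" where "\<Omega> \<equiv> fobj (Unshift C)"
abbreviation \<Omega>\<^sub>a :: "'m \<Rightarrow> 'm" where "\<Omega>\<^sub>a \<equiv> farr (Unshift C)"

lemma Shift_functor: "is_functor C C (Shift C)"
  using Shift_additive by (simp add: additive_functor_def)

lemma Unshift_Shift_isomorphic: "X \<in> Obj C \<Longrightarrow> isomorphic C X (\<Omega> (\<Sigma> X))"
  using Unshift_Shift nat_iso_isomorphic[of C C id_fun "Unshift C \<circ>\<circ> Shift C" _ X]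
  by (auto simp: id_fun_def comp_fun_def)

lemma Shift_Unshift_isomorphic: "X \<in> Obj C \<Longrightarrow> isomorphic C (\<Sigma> (\<Omega> X)) X"
  using Shift_Unshift nat_iso_isomorphic[of C C "Shift C \<circ>\<circ> Unshift C" id_fun _ X]
  by (auto simp: id_fun_def comp_fun_def)

lemma Shift_reflects_isomorphic:
  assumes "isomorphic C (\<Sigma> X) (\<Sigma> Y)" "X \<in> Obj C" "Y \<in> Obj C"
  shows "isomorphic C X Y"
proof -
  have "isomorphic C (\<Omega> (\<Sigma> X)) (\<Omega> (\<Sigma> Y))"
    using functor_isomorphic[OF category_axioms Unshift_functor assms(1)] .
  then show ?thesis
    using Unshift_Shift_isomorphic assms isomorphic_trans isomorphic_sym by meson
qed

text \<open>
  An arrow \<open>k\<close> is recovered from $\Sigma \Sigma^{-1} k$ by conjugating with the counit.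
\<close>

lemma Unshift_faithful:
  assumes f: "f \<in> Hom C X Y" and g: "g \<in> Hom C X Y" and eq: "\<Omega>\<^sub>a f = \<Omega>\<^sub>a g"
  shows "f = g"
proof -
  obtain \<epsilon> where \<epsilon>: "nat_iso C C (Shift C \<circ>\<circ> Unshift C) id_fun \<epsilon>"
    using Shift_Unshift by blast
  have "iso_arr C (\<Sigma> (\<Omega> X)) X (\<epsilon> X)"
    using \<epsilon> Hom_Obj[OF f] by (simp add: nat_iso_def id_fun_def comp_fun_def)
  then obtain r where r: "\<epsilon> X \<in> Hom C (\<Sigma> (\<Omega> X)) X" "r \<in> Hom C X (\<Sigma> (\<Omega> X))" "\<epsilon> X \<cdot> r = Ident C X"
    by (rule iso_arrE)
  have "k = (\<epsilon> Y \<cdot> \<Sigma>\<^sub>a (\<Omega>\<^sub>a k)) \<cdot> r" if "k \<in> Hom C X Y" for k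
  proof -
    have "\<epsilon> Y \<cdot> \<Sigma>\<^sub>a (\<Omega>\<^sub>a k) = k \<cdot> \<epsilon> X"
      using \<epsilon> that by (simp add: nat_iso_def id_fun_def comp_fun_def)
    then show ?thesis
      using Comp_assoc[OF r(2) r(1) that] r(3) Ident_right[OF that] by simp
  qed
  then show ?thesis using f g eq by metis
qed

text \<open>
  Conjugating $\Sigma^{-1} g$ with the unit gives an \<open>f\<close> such that $\Sigma^{-1}\Sigma f = \Sigma^{-1} g$,
  and faithfulness of $\Sigma^{-1}$ removes the outer $\Sigma^{-1}$.
\<close>

lemma Shift_full:
  assumes g: "g \<in> Hom C (\<Sigma> X) (\<Sigma> Y)" and X: "X \<in> Obj C" and Y: "Y \<in> Obj C"
  obtains f where "f \<in> Hom C X Y" "\<Sigma>\<^sub>a f = g"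
proof -
  obtain \<eta> where \<eta>: "nat_iso C C id_fun (Unshift C \<circ>\<circ> Shift C) \<eta>"
    using Unshift_Shift by blast
  have "iso_arr C X (\<Omega> (\<Sigma> X)) (\<eta> X)" "iso_arr C Y (\<Omega> (\<Sigma> Y)) (\<eta> Y)"
    using \<eta> X Y by (simp_all add: nat_iso_def id_fun_def comp_fun_def)
  then obtain r s where
    r: "\<eta> X \<in> Hom C X (\<Omega> (\<Sigma> X))" "r \<in> Hom C (\<Omega> (\<Sigma> X)) X" "\<eta> X \<cdot> r = Ident C (\<Omega> (\<Sigma> X))" and
    s: "\<eta> Y \<in> Hom C Y (\<Omega> (\<Sigma> Y))" "s \<in> Hom C (\<Omega> (\<Sigma> Y)) Y" "\<eta> Y \<cdot> s = Ident C (\<Omega> (\<Sigma> Y))"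
    by (metis iso_arrE)
  have Ug: "\<Omega>\<^sub>a g \<in> Hom C (\<Omega> (\<Sigma> X)) (\<Omega> (\<Sigma> Y))"
    using is_functor_Hom[OF Unshift_functor g] .
  define f where "f = s \<cdot> (\<Omega>\<^sub>a g \<cdot> \<eta> X)"
  note H = Comp_closed[OF r(1) Ug]
  have f: "f \<in> Hom C X Y" unfolding f_def using Comp_closed[OF H s(2)] .
  have Sf: "\<Sigma>\<^sub>a f \<in> Hom C (\<Sigma> X) (\<Sigma> Y)" using is_functor_Hom[OF Shift_functor f] .
  have USf: "\<Omega>\<^sub>a (\<Sigma>\<^sub>a f) \<in> Hom C (\<Omega> (\<Sigma> X)) (\<Omega> (\<Sigma> Y))"
    using is_functor_Hom[OF Unshift_functor Sf] .
  have "\<eta> Y \<cdot> f = \<Omega>\<^sub>a g \<cdot> \<eta> X"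
    unfolding f_def using Comp_assoc[OF H s(2) s(1)] s(3) Ident_left[OF H] by simp
  moreover have "\<eta> Y \<cdot> f = \<Omega>\<^sub>a (\<Sigma>\<^sub>a f) \<cdot> \<eta> X"
    using \<eta> f by (simp add: nat_iso_def id_fun_def comp_fun_def)
  ultimately have "(\<Omega>\<^sub>a (\<Sigma>\<^sub>a f) \<cdot> \<eta> X) \<cdot> r = (\<Omega>\<^sub>a g \<cdot> \<eta> X) \<cdot> r" by simp
  then have "\<Omega>\<^sub>a (\<Sigma>\<^sub>a f) = \<Omega>\<^sub>a g"
    using Comp_assoc[OF r(2) r(1) USf] Comp_assoc[OF r(2) r(1) Ug] r(3)
      Ident_right[OF USf] Ident_right[OF Ug] by simp
  then have "\<Sigma>\<^sub>a f = g" using Unshift_faithful[OF Sf g] by blast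
  then show ?thesis using that f by blast
qed


section \<open>Existence and uniqueness of triangles on a given morphism\<close>

text \<open>
  Since $d f = 0$, the pair $(0, d)$ maps $X \to Y$ to the first arrow of the triangle
  $0 \to W \to W \to \Sigma 0$, and TR3 supplies a third component, which is the factorization.
\<close>

lemma weak_cokernel:
  assumes t: "dist_triangle C X Y Z f g h" and d: "d \<in> Hom C Y W" and df: "d \<cdot> f = Zero C X W"
  obtains e where "e \<in> Hom C Z W" "e \<cdot> g = d"
proof -
  note tD = dist_triangleD[OF t]
  obtain N where N: "zero_obj C N" using zero_obj_exists by blast
  have SN: "zero_obj C (\<Sigma> N)"
    using additive_functor_zero_obj[OF additive_category_axioms additive_category_axioms
      Shift_additive N] .
  have W: "W \<in> Obj C" using Hom_Obj[OF d] by simp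
  have NO: "N \<in> Obj C" "\<Sigma> N \<in> Obj C" using N SN by (simp_all add: zero_obj_def)
  have SW: "\<Sigma> W \<in> Obj C" using is_functor_Obj[OF Shift_functor W] .
  have "candidate C N W W (Zero C N W) (Ident C W) (Zero C W (\<Sigma> N))"
    using W NO Zero_closed Ident_closed by (simp add: candidate_def)
  \<comment> \<open>Rotating this candidate once gives the triangle of TR1 on the identity of \<open>W\<close>.\<close>
  moreover have "dist_triangle C W W (\<Sigma> N) (Ident C W) (Zero C W (\<Sigma> N)) (Neg C (\<Sigma>\<^sub>a (Zero C N W)))"
    using TR1_ident[OF W SN]
      additive_functor_Zero[OF additive_category_axioms additive_category_axioms Shift_additive NO(1) W]
      Neg_Zero[OF NO(2) SW] by simp
  ultimately have t': "dist_triangle C N W W (Zero C N W) (Ident C W) (Zero C W (\<Sigma> N))"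
    using TR2 by blast
  have "d \<cdot> f = Zero C N W \<cdot> Zero C X N"
    using df Zero_Comp[OF Zero_closed[OF tD(1) NO(1)] W] by simp
  then obtain e where "e \<in> Hom C Z W" "e \<cdot> g = Ident C W \<cdot> d"
    using TR3[OF t t' Zero_closed[OF tD(1) NO(1)] d] by blast
  then show ?thesis using that Ident_left[OF d] by simp
qed

lemma rotate:
  "dist_triangle C X Y Z f g h \<Longrightarrow> dist_triangle C Y Z (\<Sigma> X) g h (Neg C (\<Sigma>\<^sub>a f))"
  using TR2[OF dist_triangleD(7)] by simp

text \<open>
  Put $d = e - 1$.  Then $d g = 0$ makes \<open>d\<close> factor through \<open>h\<close>, and $h d = 0$ then gives
  $d^2 = 0$, so that $1 - d$ is inverse to $e = 1 + d$.
\<close>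

lemma triangle_endo_iso:
  assumes t: "dist_triangle C X Y Z f g h" and e: "e \<in> Hom C Z Z" and eg: "e \<cdot> g = g" and he: "h \<cdot> e = h"
  shows "iso_arr C Z Z e"
proof -
  note tD = dist_triangleD[OF t]
  note I = Ident_closed[OF tD(3)]
  obtain d where d: "d \<in> Hom C Z Z" "d \<oplus> Ident C Z = e"
    using difference_exists[OF I e] .
  have "d \<cdot> g \<oplus> g = Zero C Y Z \<oplus> g"
    using Comp_Plus_left[OF tD(5) d(1) I] d(2) eg Ident_left[OF tD(5)] Plus_Zero[OF tD(5)] by simp
  then have dg: "d \<cdot> g = Zero C Y Z"
    using Plus_cancel[OF Comp_closed[OF tD(5) d(1)] Zero_closed[OF tD(2,3)] tD(5)] by simp
  have "h \<cdot> d \<oplus> h = Zero C Z (\<Sigma> X) \<oplus> h"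
    using Comp_Plus_right[OF d(1) I tD(6)] d(2) he Ident_right[OF tD(6)] Plus_Zero[OF tD(6)] by simp
  then have hd: "h \<cdot> d = Zero C Z (\<Sigma> X)"
    using Plus_cancel[OF Comp_closed[OF d(1) tD(6)] Zero_closed[OF tD(3)] tD(6)]
      is_functor_Obj[OF Shift_functor tD(1)] by simp
  obtain k where k: "k \<in> Hom C (\<Sigma> X) Z" "k \<cdot> h = d"
    using weak_cokernel[OF rotate[OF t] d(1) dg] .
  have dd: "d \<cdot> d = Zero C Z Z"
    using Comp_assoc[OF d(1) tD(6) k(1)] hd k(2) Comp_Zero[OF k(1) tD(3)] by simp
  obtain n where n: "n \<in> Hom C Z Z" "n \<oplus> d = Ident C Z"
    using difference_exists[OF d(1) I] .
  note nd = Comp_closed[OF d(1) n(1)] and dn = Comp_closed[OF n(1) d(1)]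
  have "n \<cdot> d = d"
    using Comp_Plus_left[OF d(1) n(1) d(1)] n(2) dd Ident_left[OF d(1)] Plus_Zero[OF nd] by simp
  then have "n \<cdot> e = Ident C Z"
    using Comp_Plus_right[OF d(1) I n(1)] d(2) n(2) Ident_right[OF n(1)] Plus_comm[OF d(1) n(1)]
    by simp
  moreover have "d \<cdot> n = d"
    using Comp_Plus_right[OF n(1) d(1) d(1)] n(2) dd Ident_right[OF d(1)] Plus_Zero[OF dn] by simp
  then have "e \<cdot> n = Ident C Z"
    using Comp_Plus_left[OF n(1) d(1) I] d(2) n(2) Ident_left[OF n(1)] Plus_comm[OF d(1) n(1)]
    by simp
  ultimately show ?thesis using e n(1) unfolding iso_arr_def by blast
qed

text \<open>
  TR3 extends the pair \<open>a\<close>, \<open>b\<close> and the pair of inverses to the third vertices.  The extensions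
  need not be inverse to each other, but both composites are covered by
  \<open>triangle_endo_iso\<close>; the next lemma isolates one of them.
\<close>

lemma TR3_composite_iso:
  assumes t: "dist_triangle C X Y Z f g h" and t': "dist_triangle C X' Y' Z' f' g' h'"
    and a: "a \<in> Hom C X X'" "a' \<in> Hom C X' X" "a' \<cdot> a = Ident C X"
    and b: "b \<in> Hom C Y Y'" "b' \<in> Hom C Y' Y" "b' \<cdot> b = Ident C Y"
    and c: "c \<in> Hom C Z Z'" "c \<cdot> g = g' \<cdot> b" "\<Sigma>\<^sub>a a \<cdot> h = h' \<cdot> c"
    and c': "c' \<in> Hom C Z' Z" "c' \<cdot> g' = g \<cdot> b'" "\<Sigma>\<^sub>a a' \<cdot> h' = h \<cdot> c'"
  shows "iso_arr C Z Z (c' \<cdot> c)"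
proof (rule triangle_endo_iso[OF t Comp_closed[OF c(1) c'(1)]])
  note tD = dist_triangleD[OF t] and tD' = dist_triangleD[OF t']
  have "(c' \<cdot> c) \<cdot> g = c' \<cdot> (g' \<cdot> b)"
    using Comp_assoc[OF tD(5) c(1) c'(1)] c(2) by simp
  also have "\<dots> = (g \<cdot> b') \<cdot> b"
    using Comp_assoc[OF b(1) tD'(5) c'(1)] c'(2) by simp
  also have "\<dots> = g"
    using Comp_assoc[OF b(1,2) tD(5)] b(3) Ident_right[OF tD(5)] by simp
  finally show "(c' \<cdot> c) \<cdot> g = g" .
  note Sa = is_functor_Hom[OF Shift_functor a(1)] is_functor_Hom[OF Shift_functor a(2)]
  have "h \<cdot> (c' \<cdot> c) = (\<Sigma>\<^sub>a a' \<cdot> h') \<cdot> c"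
    using Comp_assoc[OF c(1) c'(1) tD(6)] c'(3) by simp
  also have "\<dots> = \<Sigma>\<^sub>a a' \<cdot> (\<Sigma>\<^sub>a a \<cdot> h)"
    using Comp_assoc[OF c(1) tD'(6) Sa(2)] c(3) by simp
  also have "\<dots> = \<Sigma>\<^sub>a (a' \<cdot> a) \<cdot> h"
    using Comp_assoc[OF tD(6) Sa] is_functor_Comp[OF Shift_functor a(1,2)] by simp
  also have "\<dots> = h"
    using a(3) is_functor_Ident[OF Shift_functor tD(1)] Ident_left[OF tD(6)] by simp
  finally show "h \<cdot> (c' \<cdot> c) = h" .
qed

lemma cone_unique:
  assumes t: "dist_triangle C X Y Z f g h" and t': "dist_triangle C X' Y' Z' f' g' h'"
    and a: "iso_arr C X X' a" and b: "iso_arr C Y Y' b" and sq: "b \<cdot> f = f' \<cdot> a"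
  shows "isomorphic C Z Z'"
proof -
  note tD = dist_triangleD[OF t] and tD' = dist_triangleD[OF t']
  obtain a' where a': "a \<in> Hom C X X'" "a' \<in> Hom C X' X" "a' \<cdot> a = Ident C X" "a \<cdot> a' = Ident C X'"
    using a by (rule iso_arrE)
  obtain b' where b': "b \<in> Hom C Y Y'" "b' \<in> Hom C Y' Y" "b' \<cdot> b = Ident C Y" "b \<cdot> b' = Ident C Y'"
    using b by (rule iso_arrE)
  have "b' \<cdot> f' = (b' \<cdot> f') \<cdot> (a \<cdot> a')"
    using a'(4) Ident_right[OF Comp_closed[OF tD'(4) b'(2)]] by simp
  also have "\<dots> = (b' \<cdot> (f' \<cdot> a)) \<cdot> a'"
    using Comp_assoc[OF a'(2,1) Comp_closed[OF tD'(4) b'(2)]] Comp_assoc[OF a'(1) tD'(4) b'(2)] by simp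
  also have "\<dots> = ((b' \<cdot> b) \<cdot> f) \<cdot> a'"
    using Comp_assoc[OF tD(4) b'(1,2)] sq by simp
  also have "\<dots> = f \<cdot> a'"
    using b'(3) Ident_left[OF tD(4)] by simp
  finally have sq': "b' \<cdot> f' = f \<cdot> a'" .
  obtain c where c: "c \<in> Hom C Z Z'" "c \<cdot> g = g' \<cdot> b" "\<Sigma>\<^sub>a a \<cdot> h = h' \<cdot> c"
    using TR3[OF t t' a'(1) b'(1) sq] by blast
  obtain c' where c': "c' \<in> Hom C Z' Z" "c' \<cdot> g' = g \<cdot> b'" "\<Sigma>\<^sub>a a' \<cdot> h' = h \<cdot> c'"
    using TR3[OF t' t a'(2) b'(2) sq'] by blast
  have "iso_arr C Z Z (c' \<cdot> c)"
    using TR3_composite_iso[OF t t' a'(1-3) b'(1-3) c c'] .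
  moreover have "iso_arr C Z' Z' (c \<cdot> c')"
    using TR3_composite_iso[OF t' t a'(2,1,4) b'(2,1,4) c' c] .
  ultimately show ?thesis
    unfolding isomorphic_def using iso_arr_if_two_sided[OF c(1) c'(1)] by blast
qed

text \<open>
  Two rotations turn the connecting morphism into the first morphism of a triangle, whose cone is
  then the shift of the middle vertex.
\<close>

lemma middle_unique:
  assumes t: "dist_triangle C X Y Z f g h" and t': "dist_triangle C X' Y' Z' f' g' h'"
    and a: "iso_arr C X X' a" and c: "iso_arr C Z Z' c" and sq: "\<Sigma>\<^sub>a a \<cdot> h = h' \<cdot> c"
  shows "isomorphic C Y Y'"
proof -
  have "isomorphic C (\<Sigma> Y) (\<Sigma> Y')"
    using cone_unique[OF rotate[OF rotate[OF t]] rotate[OF rotate[OF t']] c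
      functor_iso_arr[OF category_axioms Shift_functor a] sq] .
  then show ?thesis
    using Shift_reflects_isomorphic dist_triangleD(2)[OF t] dist_triangleD(2)[OF t'] by blast
qed

text \<open>
  Desuspend \<open>h\<close> to an arrow $k : \Sigma^{-1} Z \to X$, form its cone, rotate once, and replace
  $\Sigma\Sigma^{-1} Z$ by \<open>Z\<close>.  The rotation changes the sign of the shifted arrow, so \<open>k\<close> is chosen to lift
  the negative of \<open>h\<close>.
\<close>

lemma cocone_exists:
  assumes h: "h \<in> Hom C Z (\<Sigma> X)" and X: "X \<in> Obj C"
  obtains Y f g where "dist_triangle C X Y Z f g h"
proof -
  have Z: "Z \<in> Obj C" using Hom_Obj[OF h] by simp
  have UZ: "\<Omega> Z \<in> Obj C" using is_functor_Obj[OF Unshift_functor Z] .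
  obtain \<epsilon> where iso: "iso_arr C (\<Sigma> (\<Omega> Z)) Z \<epsilon>"
    using Shift_Unshift_isomorphic[OF Z] unfolding isomorphic_def by blast
  note \<epsilon> = iso_arr_Hom[OF iso]
  note h\<epsilon> = Comp_closed[OF \<epsilon> h]
  obtain k where k: "k \<in> Hom C (\<Omega> Z) X" "\<Sigma>\<^sub>a k = Neg C (h \<cdot> \<epsilon>)"
    using Shift_full[OF Neg_closed[OF h\<epsilon>] UZ X] .
  obtain Y u w where "dist_triangle C (\<Omega> Z) X Y k u w"
    using TR1_cone[OF k(1)] by blast
  from rotate[OF this] have t: "dist_triangle C X Y (\<Sigma> (\<Omega> Z)) u w (h \<cdot> \<epsilon>)"
    using k(2) Neg_Neg[OF h\<epsilon>] by simp
  note tD = dist_triangleD[OF t]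
  have "dist_triangle C X Y Z u (\<epsilon> \<cdot> w) h"
  proof (rule TR1_iso[OF t _ iso_arr_Ident[OF tD(1)] iso_arr_Ident[OF tD(2)] iso])
    show "candidate C X Y Z u (\<epsilon> \<cdot> w) h"
      using tD Z h Comp_closed[OF tD(5) \<epsilon>] by (simp add: candidate_def)
    show "Ident C Y \<cdot> u = u \<cdot> Ident C X"
      using Ident_left[OF tD(4)] Ident_right[OF tD(4)] by simp
    show "\<epsilon> \<cdot> w = (\<epsilon> \<cdot> w) \<cdot> Ident C Y"
      using Ident_right[OF Comp_closed[OF tD(5) \<epsilon>]] by simp
    show "\<Sigma>\<^sub>a (Ident C X) \<cdot> h \<cdot> \<epsilon> = h \<cdot> \<epsilon>"
      using is_functor_Ident[OF Shift_functor X] Ident_left[OF h\<epsilon>] by simp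
  qed
  then show ?thesis using that by blast
qed

text \<open>
  The triangle $X \to X \to 0 \to \Sigma X$ on the identity makes every \<open>X\<close> an extension of itself
  and a zero object.
\<close>

lemma subset_ext_prod_self:
  assumes "A \<subseteq> Obj C" "Z \<in> A" "zero_obj C Z"
  shows "A \<subseteq> ext_prod C A A"
  unfolding ext_prod_def using assms TR1_ident by blast

end


section \<open>Essential images under full triangulated functors\<close>

locale full_triangulated_functor =
  T: triangulated_category T + S: triangulated_category S
  for T :: "('o, 'm, 'x) tri_cat_scheme" and S :: "('p, 'q, 'y) tri_cat_scheme" +
  fixes F :: "('o, 'm, 'p, 'q) fun_data" and \<phi> :: "'o \<Rightarrow> 'q"
  assumes triangulated: "triangulated_functor T S F \<phi>" and full: "full_functor T S F"
begin

lemma F_additive: "additive_functor T S F"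
  using triangulated by (simp add: triangulated_functor_def)

lemma F_functor: "is_functor T S F"
  using full by (simp add: full_functor_def)

lemma F_triangle:
  "dist_triangle T X Y Z f g h \<Longrightarrow>
    dist_triangle S (fobj F X) (fobj F Y) (fobj F Z) (farr F f) (farr F g) (\<phi> X \<cdot>\<^bsub>S\<^esub> farr F h)"
  using triangulated unfolding triangulated_functor_def by blast

lemma \<phi>_iso: "X \<in> Obj T \<Longrightarrow> iso_arr S (fobj F (T.\<Sigma> X)) (S.\<Sigma> (fobj F X)) (\<phi> X)"
  using triangulated by (simp add: triangulated_functor_def nat_iso_def comp_fun_def)

lemma F_Shift_isomorphic:
  "X \<in> Obj T \<Longrightarrow> isomorphic S (fobj F (T.\<Sigma> X)) (S.\<Sigma> (fobj F X))"
  unfolding isomorphic_def using \<phi>_iso by blast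

text \<open>
  Shifting both sides reduces the claim to
  $\Sigma \Sigma^{-1} F X \simeq F X \simeq F \Sigma \Sigma^{-1} X \simeq \Sigma F \Sigma^{-1} X$.
\<close>

lemma F_Unshift_isomorphic:
  assumes X: "X \<in> Obj T"
  shows "isomorphic S (S.\<Omega> (fobj F X)) (fobj F (T.\<Omega> X))"
proof (rule S.Shift_reflects_isomorphic)
  have UX: "T.\<Omega> X \<in> Obj T" using is_functor_Obj[OF T.Unshift_functor X] .
  have FX: "fobj F X \<in> Obj S" using is_functor_Obj[OF F_functor X] .
  have "isomorphic S (S.\<Sigma> (S.\<Omega> (fobj F X))) (fobj F X)"
    using S.Shift_Unshift_isomorphic[OF FX] .
  moreover have "isomorphic S (fobj F X) (fobj F (T.\<Sigma> (T.\<Omega> X)))"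
    using functor_isomorphic[OF T.category_axioms F_functor T.Shift_Unshift_isomorphic[OF X]]
      S.isomorphic_sym by blast
  ultimately show "isomorphic S (S.\<Sigma> (S.\<Omega> (fobj F X))) (S.\<Sigma> (fobj F (T.\<Omega> X)))"
    using F_Shift_isomorphic[OF UX] S.isomorphic_trans by blast
  show "S.\<Omega> (fobj F X) \<in> Obj S" using is_functor_Obj[OF S.Unshift_functor FX] .
  show "fobj F (T.\<Omega> X) \<in> Obj S" using is_functor_Obj[OF F_functor UX] .
qed

text \<open>
  Fullness enters here: it lifts the connecting morphism of a triangle in \<open>S\<close> to an arrow of \<open>T\<close>,
  which in turn has a cocone.  The lifted triangle and the given one then have isomorphic middle
  vertices.
\<close>

lemma ext_prod_ess_image_subset:
  assumes "A \<subseteq> Obj T" "B \<subseteq> Obj T"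
  shows "ext_prod S (ess_image S F A) (ess_image S F B) \<subseteq> ess_image S F (ext_prod T A B)"
proof
  fix Y assume "Y \<in> ext_prod S (ess_image S F A) (ess_image S F B)"
  then obtain X Z f g h where X: "X \<in> ess_image S F A" and Z: "Z \<in> ess_image S F B"
    and t: "dist_triangle S X Y Z f g h"
    unfolding ext_prod_def by blast
  obtain X' a where X': "X' \<in> A" and a: "iso_arr S X (fobj F X') a"
    using X unfolding ess_image_def isomorphic_def by blast
  obtain Z' c where Z': "Z' \<in> B" and c: "iso_arr S Z (fobj F Z') c"
    using Z unfolding ess_image_def isomorphic_def by blast
  note tD = dist_triangleD[OF t]
  have O: "X' \<in> Obj T" "Z' \<in> Obj T" using X' Z' assms by auto
  obtain c' where c': "c \<in> Hom S Z (fobj F Z')" "c' \<in> Hom S (fobj F Z') Z" "c' \<cdot>\<^bsub>S\<^esub> c = Ident S Z"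
    using c by (rule iso_arrE)
  obtain \<psi> where \<psi>: "\<phi> X' \<in> Hom S (fobj F (T.\<Sigma> X')) (S.\<Sigma> (fobj F X'))"
      "\<psi> \<in> Hom S (S.\<Sigma> (fobj F X')) (fobj F (T.\<Sigma> X'))"
      "\<phi> X' \<cdot>\<^bsub>S\<^esub> \<psi> = Ident S (S.\<Sigma> (fobj F X'))"
    using \<phi>_iso[OF O(1)] by (rule iso_arrE)
  note Sa = is_functor_Hom[OF S.Shift_functor iso_arr_Hom[OF a]]
  note Sah = S.Comp_closed[OF tD(6) Sa]
  \<comment> \<open>The given connecting morphism, transported to the chosen objects of the image of \<open>F\<close>.\<close>
  define k where "k = (S.\<Sigma>\<^sub>a a \<cdot>\<^bsub>S\<^esub> h) \<cdot>\<^bsub>S\<^esub> c'"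
  have k: "k \<in> Hom S (fobj F Z') (S.\<Sigma> (fobj F X'))"
    unfolding k_def using S.Comp_closed[OF c'(2) Sah] .
  obtain h' where h': "h' \<in> Hom T Z' (T.\<Sigma> X')" "farr F h' = \<psi> \<cdot>\<^bsub>S\<^esub> k"
    using full O is_functor_Obj[OF T.Shift_functor O(1)] S.Comp_closed[OF k \<psi>(2)]
    unfolding full_functor_def by blast
  have \<phi>h': "\<phi> X' \<cdot>\<^bsub>S\<^esub> farr F h' = k"
    using h'(2) S.Comp_assoc[OF k \<psi>(2,1)] \<psi>(3) S.Ident_left[OF k] by simp
  obtain Y' u v where t': "dist_triangle T X' Y' Z' u v h'"
    using T.cocone_exists[OF h'(1) O(1)] .
  have Y': "Y' \<in> ext_prod T A B"
    using t' X' Z' dist_triangleD(2)[OF t'] unfolding ext_prod_def by blast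
  have "S.\<Sigma>\<^sub>a a \<cdot>\<^bsub>S\<^esub> h = k \<cdot>\<^bsub>S\<^esub> c"
    unfolding k_def using S.Comp_assoc[OF c'(1,2) Sah] c'(3) S.Ident_right[OF Sah] by simp
  then have "isomorphic S Y (fobj F Y')"
    using S.middle_unique[OF t F_triangle[OF t'] a c] \<phi>h' by simp
  then show "Y \<in> ess_image S F (ext_prod T A B)"
    by (rule ess_imageI[OF S.category_axioms _ Y'])
qed

lemma metric_ess_image:
  assumes "metric T B"
  shows "metric S (\<lambda>n. ess_image S F (B n))"
  unfolding metric_def
proof (intro allI impI conjI)
  fix n :: nat assume "n \<ge> 1"
  then have B: "B n \<subseteq> Obj T" "B (Suc n) \<subseteq> B n" "ext_prod T (B n) (B n) = B n"
    and "\<exists>Z\<in>B n. zero_obj T Z"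
    using assms unfolding metric_def by blast+
  then obtain Z where Z: "Z \<in> B n" "zero_obj T Z" by blast
  show sub: "ess_image S F (B n) \<subseteq> Obj S" unfolding ess_image_def by blast
  show "ess_image S F (B (Suc n)) \<subseteq> ess_image S F (B n)" using ess_image_mono[OF B(2)] .
  have zero: "zero_obj S (fobj F Z)"
    using additive_functor_zero_obj[OF T.additive_category_axioms S.additive_category_axioms
      F_additive Z(2)] .
  have FZ: "fobj F Z \<in> ess_image S F (B n)"
    using zero by (intro ess_imageI[OF S.category_axioms S.isomorphic_refl Z(1)])
      (simp add: zero_obj_def)
  show "\<exists>Z\<in>ess_image S F (B n). zero_obj S Z" using zero FZ by blast
  show "ext_prod S (ess_image S F (B n)) (ess_image S F (B n)) = ess_image S F (B n)"
    using ext_prod_ess_image_subset[OF B(1) B(1)] B(3) S.subset_ext_prod_self[OF sub FZ zero] by auto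
qed

lemma Shift_ess_image_subset:
  assumes "A \<subseteq> Obj T"
  shows "ess_image S (Shift S) (ess_image S F A) \<subseteq> ess_image S F (ess_image T (Shift T) A)"
proof
  fix Y assume "Y \<in> ess_image S (Shift S) (ess_image S F A)"
  then obtain Z where Z: "Z \<in> ess_image S F A" "isomorphic S Y (S.\<Sigma> Z)" by (rule ess_imageE)
  obtain X where X: "X \<in> A" "isomorphic S Z (fobj F X)" using Z(1) by (rule ess_imageE)
  have XO: "X \<in> Obj T" using X assms by blast
  have "isomorphic S Y (fobj F (T.\<Sigma> X))"
    using Z(2) functor_isomorphic[OF S.category_axioms S.Shift_functor X(2)]
      F_Shift_isomorphic[OF XO] S.isomorphic_trans S.isomorphic_sym by meson
  moreover have "T.\<Sigma> X \<in> ess_image T (Shift T) A"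
    by (rule ess_imageI[OF T.category_axioms T.isomorphic_refl X(1)])
      (rule is_functor_Obj[OF T.Shift_functor XO])
  ultimately show "Y \<in> ess_image S F (ess_image T (Shift T) A)"
    by (rule ess_imageI[OF S.category_axioms])
qed

lemma Unshift_ess_image_subset:
  assumes "A \<subseteq> Obj T"
  shows "ess_image S (Unshift S) (ess_image S F A) \<subseteq> ess_image S F (ess_image T (Unshift T) A)"
proof
  fix Y assume "Y \<in> ess_image S (Unshift S) (ess_image S F A)"
  then obtain Z where Z: "Z \<in> ess_image S F A" "isomorphic S Y (S.\<Omega> Z)" by (rule ess_imageE)
  obtain X where X: "X \<in> A" "isomorphic S Z (fobj F X)" using Z(1) by (rule ess_imageE)
  have XO: "X \<in> Obj T" using X assms by blast
  have "isomorphic S Y (fobj F (T.\<Omega> X))"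
    using Z(2) functor_isomorphic[OF S.category_axioms S.Unshift_functor X(2)]
      F_Unshift_isomorphic[OF XO] S.isomorphic_trans by meson
  moreover have "T.\<Omega> X \<in> ess_image T (Unshift T) A"
    by (rule ess_imageI[OF T.category_axioms T.isomorphic_refl X(1)])
      (rule is_functor_Obj[OF T.Unshift_functor XO])
  ultimately show "Y \<in> ess_image S F (ess_image T (Unshift T) A)"
    by (rule ess_imageI[OF S.category_axioms])
qed

lemma good_metric_ess_image:
  assumes "good_metric T B"
  shows "good_metric S (\<lambda>n. ess_image S F (B n))"
  unfolding good_metric_def
proof (intro allI impI conjI)
  have m: "metric T B" using assms by (simp add: good_metric_def)
  show "metric S (\<lambda>n. ess_image S F (B n))" using metric_ess_image[OF m] .
  fix n :: nat assume n: "n \<ge> 1"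
  have O: "B (Suc n) \<subseteq> Obj T" using m n unfolding metric_def by blast
  have good: "ess_image T (Unshift T) (B (Suc n)) \<subseteq> B n" "B (Suc n) \<subseteq> B n"
      "ess_image T (Shift T) (B (Suc n)) \<subseteq> B n"
    using assms n unfolding good_metric_def by blast+
  show "ess_image S (Unshift S) (ess_image S F (B (Suc n))) \<union> ess_image S F (B (Suc n)) \<union>
      ess_image S (Shift S) (ess_image S F (B (Suc n))) \<subseteq> ess_image S F (B n)"
    using Unshift_ess_image_subset[OF O] Shift_ess_image_subset[OF O]
      good[THEN ess_image_mono[where D = S and F = F]] by blast
qed

end

theorem lemma4p14:
  fixes T :: "('o, 'm) tri_cat" and S :: "('p, 'q) tri_cat"
    and F :: "('o, 'm, 'p, 'q) fun_data" and \<phi> :: "'o \<Rightarrow> 'q"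
    and B :: "nat \<Rightarrow> 'o set"
  assumes "triangulated_category T" and "triangulated_category S"
    and "triangulated_functor T S F \<phi>" and "full_functor T S F"
  shows "(metric T B \<longrightarrow> metric S (\<lambda>n. ess_image S F (B n))) \<and>
         (good_metric T B \<longrightarrow> good_metric S (\<lambda>n. ess_image S F (B n)))"
proof -
  interpret full_triangulated_functor T S F \<phi>
    using assms by (simp add: full_triangulated_functor_def full_triangulated_functor_axioms_def)
  show ?thesis using metric_ess_image good_metric_ess_image by blast
qed

end
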